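(* Let $k\le m$, let $\mathbf{V}\in\mathbb{R}^{m\times k}$ have orthonormal columns ($\mathbf{V}^T\mathbf{V}=\mathbf{I}_k$), and let $\mathbf{A}\in\mathbb{R}^{m\times m}$ be a real symmetric matrix. Then $\mathbf{V}^T\mathbf{A}\mathbf{V}$ is also a real symmetric matrix. *)

theory Defs
  imports "Jordan_Normal_Form.Matrix"
begin

definition symmetric_mat :: "'a mat \<Rightarrow> bool" where
  "symmetric_mat A \<longleftrightarrow> transpose_mat A = A"

end

theory Submission
  imports Defs
begin

text \<open>Over commutative scalars transposition reverses products (\<open>transpose_mult\<close>)
  and is an involution, so the transpose of V^T A V is V^T A^T V, which is V^T A V once A^T = A. The
  argument is purely algebraic and works entrywise in any \<open>comm_semiring_0\<close>.\<close>

lemma symmetric_mat_congruence: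
  fixes A V :: "'a :: comm_semiring_0 mat"
  assumes V: "V \<in> carrier_mat m k" and A: "A \<in> carrier_mat m m" and "symmetric_mat A"
  shows "symmetric_mat (transpose_mat V * A * V)"
proof -
  have VT: "transpose_mat V \<in> carrier_mat k m" using V by simp
  have "transpose_mat (transpose_mat V * A * V)
      = transpose_mat V * transpose_mat (transpose_mat V * A)"
    by (rule transpose_mult[OF mult_carrier_mat[OF VT A] V])
  \<comment> \<open>The second reversal gives A^T (V^T)^T; this is where the symmetry of A
    enters.\<close>
  also have "transpose_mat (transpose_mat V * A) = A * V"
    using transpose_mult[OF VT A] \<open>symmetric_mat A\<close> by (simp add: symmetric_mat_def)
  \<comment> \<open>Reversal has moved the brackets to the right; associativity restores the
    original form.\<close>
  also have "transpose_mat V * (A * V) = transpose_mat V * A * V"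
    by (rule assoc_mult_mat[OF VT A V, symmetric])
  finally show ?thesis by (simp add: symmetric_mat_def)
qed

theorem mainTheorem4:
  fixes m k :: nat and V A :: "real mat"
  assumes "k \<le> m"
    and "V \<in> carrier_mat m k"
    and "transpose_mat V * V = 1\<^sub>m k"
    and "A \<in> carrier_mat m m"
    and "symmetric_mat A"
  shows "transpose_mat V * A * V \<in> carrier_mat k k \<and>
    symmetric_mat (transpose_mat V * A * V)"
  using assms symmetric_mat_congruence[of V m k A] by auto

end
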